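(* Let $\mathbb{F}\in\{\mathbb{R},\mathbb{C}\}$ and $\Omega=k^{-1/2}[\omega_1,\dots,\omega_k]\in\mathbb{F}^{d\times k}$ where $\omega_i$ are iid copies of an isotropic random vector $\omega\in\mathbb{F}^d$. Suppose that $\mathbb{P}\{|\langle u,\omega\rangle|^2\ge\tau\}\ge0.99$ for all unit vectors $u\in\mathbb{F}^d$ and some $\tau>0$. Then for every fixed matrix $Q\in\mathbb{F}^{d\times r}$ with orthonormal columns, $\sigma_{\min}(Q^*\Omega)\ge\tau/10$ with probability at least $1-\delta$, provided $k\ge\max\{4r,10\log(1/\delta)\}$ if $\mathbb{F}=\mathbb{R}$, or $k\ge\max\{18r,57\log(1/\delta)\}$ if $\mathbb{F}=\mathbb{C}$.
   Context: Isotropic means $\mathbb{E}[\omega\omega^*]=I$; $\langle x,y\rangle=x^*y$; $^*$ conjugate transpose; $\sigma_{\min}(Q^*\Omega)=\min_{\|u\|_2=1}\|u^*Q^*\Omega\|_2$; $\delta\in(0,1)$. *)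

theory Defs
  imports "HOL-Probability.Probability" "Jordan_Normal_Form.Conjugate"
begin

text \<open>
  The scalar fields are treated uniformly through \<^const>\<open>conjugate\<close>, which is the identity
  on \<^typ>\<open>real\<close> and \<^const>\<open>cnj\<close> on \<^typ>\<open>complex\<close>.
\<close>

definition conj_vec :: "'f::conjugate ^ 'n \<Rightarrow> 'f ^ 'n" where
  "conj_vec x = (\<chi> i. conjugate (x $ i))"

definition conj_transpose :: "'f::conjugate ^ 'n ^ 'm \<Rightarrow> 'f ^ 'm ^ 'n" where
  "conj_transpose A = (\<chi> i j. conjugate (A $ j $ i))"

text \<open>Conjugate-linear in the first argument: this is \<open>x\<^sup>* y\<close>.\<close>

definition conj_inner :: "'f::conjugatable_field ^ 'n \<Rightarrow> 'f ^ 'n \<Rightarrow> 'f" where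
  "conj_inner x y = (\<Sum>i\<in>UNIV. conjugate (x $ i) * y $ i)"

definition outer_self :: "'f::conjugatable_field ^ 'n \<Rightarrow> 'f ^ 'n ^ 'n" where
  "outer_self x = (\<chi> i j. x $ i * conjugate (x $ j))"

definition orthonormal_columns :: "'f::conjugatable_field ^ 'r ^ 'd \<Rightarrow> bool" where
  "orthonormal_columns Q \<longleftrightarrow>
     (\<forall>i j. conj_inner (column i Q) (column j Q) = (if i = j then 1 else 0))"

text \<open>
  The minimum of \<open>\<parallel>u\<^sup>* A\<parallel>\<^sub>2\<close> over unit vectors, \<open>u\<^sup>* A\<close> being a row vector.
  It is written as an infimum; for the two scalar fields of interest the infimum is attained, see
  \<open>sigma_min_attained_real\<close> and \<open>sigma_min_attained_complex\<close> below.
\<close>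

definition sigma_min :: "'f::{conjugatable_field, real_normed_field} ^ 'k ^ 'r \<Rightarrow> real" where
  "sigma_min A = (INF u \<in> {u. norm u = 1}. norm (conj_vec u v* A))"

text \<open>Isotropic: \<open>E[\<omega> \<omega>\<^sup>*] = I\<close>, as a matrix-valued Bochner integral.\<close>

definition isotropic ::
    "'b measure \<Rightarrow> ('b \<Rightarrow> 'f::{conjugatable_field, euclidean_space} ^ 'd) \<Rightarrow> bool" where
  "isotropic N \<omega> \<longleftrightarrow> has_bochner_integral N (\<lambda>y. outer_self (\<omega> y)) (mat 1)"

text \<open>
  The family \<open>X\<close> lives on \<open>M\<close> and the reference random vector \<open>\<omega>\<close> on a possibly
  different space \<open>N\<close>.
\<close>

definition iid_copies ::
    "'a measure \<Rightarrow> ('k \<Rightarrow> 'a \<Rightarrow> 'v::topological_space) \<Rightarrow> 'b measure \<Rightarrow> ('b \<Rightarrow> 'v) \<Rightarrow> bool" where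
  "iid_copies M X N \<omega> \<longleftrightarrow>
     prob_space.indep_vars M (\<lambda>_. borel) X UNIV \<and>
     (\<forall>i. distr M borel (X i) = distr N borel \<omega>)"

text \<open>The matrix \<open>k\<^sup>-\<^sup>1\<^sup>/\<^sup>2 [x\<^sub>1, \<dots>, x\<^sub>k]\<close>, with \<open>k = CARD('k)\<close> columns.\<close>

definition sketch_matrix :: "('k \<Rightarrow> 'f::real_normed_field ^ 'd) \<Rightarrow> 'f ^ 'k ^ 'd" where
  "sketch_matrix x = (\<chi> i j. of_real (1 / sqrt (real CARD('k))) * x j $ i)"

lemma sigma_min_attained:
  fixes A :: "'f::{conjugatable_field, real_normed_field, euclidean_space} ^ 'k ^ 'r"
  assumes "continuous_on UNIV (conjugate :: 'f \<Rightarrow> 'f)"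
  obtains u where "norm u = 1" "sigma_min A = norm (conj_vec u v* A)"
    "\<And>v. norm v = 1 \<Longrightarrow> norm (conj_vec u v* A) \<le> norm (conj_vec v v* A)"
proof -
  let ?S = "{u :: 'f ^ 'r. norm u = 1}" and ?f = "\<lambda>u. norm (conj_vec u v* A)"
  have S: "?S = sphere 0 1" by (auto simp: sphere_def)
  have c: "continuous_on ?S (\<lambda>u. conjugate (u $ i))" for i
    by (rule continuous_on_compose2[OF assms]) (auto intro!: continuous_intros)
  have "continuous_on ?S ?f"
    unfolding conj_vec_def vector_matrix_mult_def
    by (intro continuous_intros continuous_on_vec_lambda) (simp, intro c)
  moreover have "compact ?S" "?S \<noteq> {}" unfolding S by simp_all
  ultimately obtain u where u: "u \<in> ?S" "\<And>v. v \<in> ?S \<Longrightarrow> ?f u \<le> ?f v"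
    using continuous_attains_inf[of ?S ?f] by blast
  have "sigma_min A = ?f u"
    unfolding sigma_min_def using u by (intro cInf_eq_minimum) auto
  with u show ?thesis using that by blast
qed

lemma sigma_min_attained_real:
  fixes A :: "real ^ 'k ^ 'r"
  obtains u where "norm u = 1" "sigma_min A = norm (conj_vec u v* A)"
    "\<And>v. norm v = 1 \<Longrightarrow> norm (conj_vec u v* A) \<le> norm (conj_vec v v* A)"
  by (rule sigma_min_attained[of A]) (auto simp: conjugate_real_def)

lemma sigma_min_attained_complex:
  fixes A :: "complex ^ 'k ^ 'r"
  obtains u where "norm u = 1" "sigma_min A = norm (conj_vec u v* A)"
    "\<And>v. norm v = 1 \<Longrightarrow> norm (conj_vec u v* A) \<le> norm (conj_vec v v* A)"
  by (rule sigma_min_attained[of A]) (auto simp: conjugate_complex_def intro!: continuous_intros)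

end

theory Submission
  imports Defs
begin

text \<open>
  Isotropy and Markov's inequality force \<open>\<tau> \<le> 1 / 0.99\<close>, so \<open>\<sigma>\<^sub>min < \<tau> / 10\<close> yields a unit vector \<open>u\<close> and an
  index set \<open>I\<close> of at least \<open>0.97 k\<close> indices with \<open>\<bar>\<langle>Q u, \<omega>\<^sub>i\<rangle>\<bar>\<^sup>2 \<le> 0.45 \<tau>\<close> for \<open>i \<in> I\<close>. Bounding
  real and imaginary parts separately and adding the box \<open>\<bar>u\<^sub>l\<bar> \<le> 1\<close> turns this into a bounded
  polytope in \<open>n\<close> real dimensions, with \<open>n = r\<close> or \<open>n = 2 r\<close>, that contains a unit vector. A point
  of maximal norm in it is a vertex: it has norm at least \<open>1\<close> and is the solution of a linear
  system involving at most \<open>n\<close> of the \<open>\<omega>\<^sub>i\<close>. The remaining \<open>\<omega>\<^sub>i\<close> with \<open>i \<in> I\<close> are independent of this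
  vertex, and each of them is small there with probability at most \<open>0.01\<close>. The union bound over \<open>I\<close>
  and over the sign patterns of the tight constraints costs only a factor \<open>C\<^sup>k\<close>, with \<open>C\<close> a small
  constant, so no bound on the norm of \<open>\<Omega>\<close> is needed.
\<close>

section \<open>Vertices of bounded symmetric polytopes\<close>

text \<open>A point \<open>u\<close> of maximal norm works: if a nonzero \<open>v\<close> were
  orthogonal to all tight normals, then \<open>u\<close> could be moved both ways along
  \<open>v\<close> inside the polytope, and one of the two moves would increase the norm. Hence the
  tight normals span the space, and a basis chosen among them gives \<open>T\<close>.\<close>

lemma norm_maximizer_tight:
  fixes c :: "'t \<Rightarrow> 'e::euclidean_space"
  assumes "finite J"
    and bdd: "bounded {u. \<forall>t\<in>J. \<bar>c t \<bullet> u\<bar> \<le> w t}"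
    and u0: "\<forall>t\<in>J. \<bar>c t \<bullet> u0\<bar> \<le> w t"
  obtains u T where "norm u0 \<le> norm u" "\<forall>t\<in>J. \<bar>c t \<bullet> u\<bar> \<le> w t" "T \<subseteq> J"
    "card T \<le> DIM('e)" "\<forall>t\<in>T. \<bar>c t \<bullet> u\<bar> = w t" "\<And>v. \<forall>t\<in>T. c t \<bullet> v = 0 \<Longrightarrow> v = 0"
proof -
  let ?P = "{u. \<forall>t\<in>J. \<bar>c t \<bullet> u\<bar> \<le> w t}"
  have "?P = (\<Inter>t\<in>J. {u. \<bar>c t \<bullet> u\<bar> \<le> w t})" by auto
  moreover have "closed {u. \<bar>c t \<bullet> u\<bar> \<le> w t}" for t
    by (intro closed_Collect_le continuous_intros)
  ultimately have "closed ?P" by auto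
  with bdd have "compact ?P" by (simp add: compact_eq_bounded_closed)
  then obtain u where u: "u \<in> ?P" "\<And>v. v \<in> ?P \<Longrightarrow> norm v \<le> norm u"
    using continuous_attains_sup[of ?P norm] u0 by (auto intro: continuous_intros)
  define A where "A = {t\<in>J. \<bar>c t \<bullet> u\<bar> = w t}"
  have A: "v = 0" if v: "\<forall>t\<in>A. c t \<bullet> v = 0" for v
  proof (rule ccontr)
    assume "v \<noteq> 0"
    \<comment> \<open>Tight constraints do not change along \<open>v\<close>, and slack ones survive
      a small move by continuity; \<open>J\<close> is finite, so one \<open>e\<close> serves all of
      them.\<close>
    have "\<forall>\<^sub>F e in at_right 0. \<forall>t\<in>J. \<bar>c t \<bullet> (u + e *\<^sub>R v)\<bar> \<le> w t \<and> \<bar>c t \<bullet> (u - e *\<^sub>R v)\<bar> \<le> w t"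
    proof (rule eventually_ball_finite[OF \<open>finite J\<close>], intro ballI)
      fix t assume t: "t \<in> J"
      show "\<forall>\<^sub>F e in at_right 0. \<bar>c t \<bullet> (u + e *\<^sub>R v)\<bar> \<le> w t \<and> \<bar>c t \<bullet> (u - e *\<^sub>R v)\<bar> \<le> w t"
      proof (cases "t \<in> A")
        case True
        with v have "c t \<bullet> v = 0" by blast
        with u(1) t show ?thesis by (simp add: inner_add_right inner_diff_right)
      next
        case False
        with t u(1) have less: "\<bar>c t \<bullet> u\<bar> < w t" by (force simp: A_def)
        have "((\<lambda>e. \<bar>c t \<bullet> (u + e *\<^sub>R v)\<bar>) \<longlongrightarrow> \<bar>c t \<bullet> (u + 0 *\<^sub>R v)\<bar>) (at_right 0)"
          "((\<lambda>e. \<bar>c t \<bullet> (u - e *\<^sub>R v)\<bar>) \<longlongrightarrow> \<bar>c t \<bullet> (u - 0 *\<^sub>R v)\<bar>) (at_right 0)"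
          by (intro tendsto_intros)+
        from order_tendstoD(2)[OF this(1)] order_tendstoD(2)[OF this(2)] less
        have "\<forall>\<^sub>F e in at_right 0. \<bar>c t \<bullet> (u + e *\<^sub>R v)\<bar> < w t"
          "\<forall>\<^sub>F e in at_right 0. \<bar>c t \<bullet> (u - e *\<^sub>R v)\<bar> < w t" by simp_all
        then show ?thesis
          by eventually_elim auto
      qed
    qed
    then have "\<forall>\<^sub>F e in at_right 0. (0::real) < e \<and>
        (\<forall>t\<in>J. \<bar>c t \<bullet> (u + e *\<^sub>R v)\<bar> \<le> w t \<and> \<bar>c t \<bullet> (u - e *\<^sub>R v)\<bar> \<le> w t)"
      by (intro eventually_conj eventually_at_right_less)
    then obtain e :: real where e: "e > 0" "u + e *\<^sub>R v \<in> ?P" "u - e *\<^sub>R v \<in> ?P"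
      by (auto dest!: eventually_happens'[OF trivial_limit_at_right_real])
    have "(norm (u + e *\<^sub>R v))\<^sup>2 \<le> (norm u)\<^sup>2" "(norm (u - e *\<^sub>R v))\<^sup>2 \<le> (norm u)\<^sup>2"
      using u(2) e by (auto intro!: power_mono)
    \<comment> \<open>The parallelogram law: the two moved points cannot both have norm at most
      \<open>norm u\<close>.\<close>
    moreover have "(norm (u + e *\<^sub>R v))\<^sup>2 + (norm (u - e *\<^sub>R v))\<^sup>2 =
        2 * (norm u)\<^sup>2 + 2 * (e\<^sup>2 * (v \<bullet> v))"
      by (simp add: power2_norm_eq_inner inner_add_left inner_add_right inner_diff_left
          inner_diff_right inner_commute power2_eq_square[of e])
    ultimately have "e\<^sup>2 * (v \<bullet> v) \<le> 0" by linarith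
    moreover have "0 < e\<^sup>2 * (v \<bullet> v)"
      using e(1) \<open>v \<noteq> 0\<close> by simp
    ultimately show False by linarith
  qed
  \<comment> \<open>Thinning: one index is kept for each member of a basis of the span of the tight
    normals. Orthogonality to the basis extends to the span, so the kernel stays trivial.\<close>
  obtain B where B: "B \<subseteq> c ` A" "independent B" "c ` A \<subseteq> span B"
    using maximal_independent_subset[of "c ` A"] by blast
  obtain T where T: "T \<subseteq> A" "inj_on c T" "B = c ` T"
    using B(1) by (auto simp: subset_image_inj)
  have "card T = card B"
    using T by (simp add: card_image)
  also have "\<dots> \<le> DIM('e)"
    using independent_bound[OF B(2)] by simp
  finally have cT: "card T \<le> DIM('e)" .
  have vT: "v = 0" if v: "\<forall>t\<in>T. c t \<bullet> v = 0" for v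
  proof (rule A, intro ballI)
    fix t assume "t \<in> A"
    then have "c t \<in> span B" using B(3) by blast
    moreover have "orthogonal v x" if "x \<in> B" for x
      using v T(3) that by (auto simp: orthogonal_def inner_commute)
    ultimately show "c t \<bullet> v = 0"
      using orthogonal_to_span[of "c t" B v] by (auto simp: orthogonal_def inner_commute)
  qed
  show ?thesis
    using that[of u T] u u0 T(1) cT vT by (auto simp: A_def)
qed

section \<open>Vertices as measurable functions of the constraints\<close>

text \<open>
  Cramer's rule for the normal equations of the system \<open>c\<^sub>t \<bullet> u = b\<^sub>t\<close>. It requires no choice of a square
  subsystem and is measurable in \<open>c\<close> without case distinction; the value is junk if the \<open>c\<^sub>t\<close> do not span.
\<close>

definition normal_solve :: "'t set \<Rightarrow> ('t \<Rightarrow> real ^ 'n) \<Rightarrow> ('t \<Rightarrow> real) \<Rightarrow> real ^ 'n" where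
  "normal_solve T c b = (\<chi> k.
     det (\<chi> i j. if j = k then \<Sum>t\<in>T. b t * c t $ i else \<Sum>t\<in>T. c t $ i * c t $ j) /
     det (\<chi> i j. \<Sum>t\<in>T. c t $ i * c t $ j))"

text \<open>The Gram matrix \<open>G\<close> satisfies \<open>(G *v v) \<bullet> v = (\<Sum>t\<in>T.
  (c t \<bullet> v)\<^sup>2)\<close>, so its kernel is the common kernel of the \<open>c t\<close>,
  which is trivial. Thus \<open>G\<close> is invertible and Cramer's rule applies to
  \<open>G *v u = r\<close>.\<close>

lemma normal_solve_eq:
  fixes c :: "'t \<Rightarrow> real ^ 'n"
  assumes "finite T" and u: "\<forall>t\<in>T. c t \<bullet> u = b t"
    and ker: "\<And>v. \<forall>t\<in>T. c t \<bullet> v = 0 \<Longrightarrow> v = 0"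
  shows "normal_solve T c b = u"
proof -
  define G :: "real ^ 'n ^ 'n" where "G = (\<chi> i j. \<Sum>t\<in>T. c t $ i * c t $ j)"
  define r :: "real ^ 'n" where "r = (\<chi> i. \<Sum>t\<in>T. b t * c t $ i)"
  have Gv: "G *v v = (\<Sum>t\<in>T. (c t \<bullet> v) *\<^sub>R c t)" for v
    unfolding vec_eq_iff G_def matrix_vector_mult_def
    by (simp add: inner_vec_def sum_distrib_right sum_distrib_left mult_ac)
      (subst sum.swap, simp)
  have "v = 0" if "G *v v = 0" for v
  proof -
    have "(\<Sum>t\<in>T. (c t \<bullet> v)\<^sup>2) = (G *v v) \<bullet> v"
      unfolding Gv by (simp add: inner_sum_left power2_eq_square)
    also have "\<dots> = 0" using that by simp
    finally show ?thesis
      using ker \<open>finite T\<close> by (simp add: sum_nonneg_eq_0_iff)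
  qed
  then have "invertible G"
    using matrix_left_invertible_ker[of G] by (simp add: invertible_left_inverse)
  then have "det G \<noteq> 0" by (simp add: invertible_det_nz)
  moreover have "G *v u = r"
    unfolding Gv r_def vec_eq_iff using u by simp
  ultimately have "u = (\<chi> k. det (\<chi> i j. if j = k then r $ i else G $ i $ j) / det G)"
    using cramer by blast
  then show ?thesis
    by (simp add: normal_solve_def G_def r_def cong: if_cong)
qed

lemma borel_measurable_vec_lambda:
  fixes f :: "'n::finite \<Rightarrow> 'a \<Rightarrow> 'b::euclidean_space"
  assumes "\<And>i. f i \<in> borel_measurable M"
  shows "(\<lambda>x. \<chi> i. f i x) \<in> borel_measurable M"
proof -
  have "(\<lambda>x. (\<chi> i. f i x) \<bullet> axis i b) \<in> borel_measurable M" for i b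
    unfolding inner_axis using assms by simp
  then show ?thesis
    by (subst borel_measurable_euclidean_space) (auto simp: Basis_vec_def)
qed

lemma borel_measurable_normal_solve:
  fixes c :: "'t \<Rightarrow> 'a \<Rightarrow> real ^ 'n"
  assumes "\<And>t. t \<in> T \<Longrightarrow> c t \<in> borel_measurable M"
  shows "(\<lambda>x. normal_solve T (\<lambda>t. c t x) b) \<in> borel_measurable M"
proof -
  have c: "(\<lambda>x. c t x $ i) \<in> borel_measurable M" if "t \<in> T" for t i
    using measurable_compose[OF assms[OF that] borel_measurable_nth] .
  have det: "(\<lambda>x. det (\<chi> i j. f i j x)) \<in> borel_measurable M"
    if "\<And>i j. f i j \<in> borel_measurable M" for f :: "'n \<Rightarrow> 'n \<Rightarrow> 'a \<Rightarrow> real"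
    unfolding det_def using that by simp
  have gram: "(\<lambda>x. \<Sum>t\<in>T. c t x $ i * c t x $ j) \<in> borel_measurable M" for i j
    by (intro borel_measurable_sum borel_measurable_times c)
  have rhs: "(\<lambda>x. \<Sum>t\<in>T. b t * c t x $ i) \<in> borel_measurable M" for i
    by (intro borel_measurable_sum borel_measurable_times borel_measurable_const c)
  have "(\<lambda>x. if j = k then \<Sum>t\<in>T. b t * c t x $ i else \<Sum>t\<in>T. c t x $ i * c t x $ j)
      \<in> borel_measurable M" for i j k :: 'n
    using gram rhs by (cases "j = k") simp_all
  then show ?thesis
    unfolding normal_solve_def
    by (intro borel_measurable_vec_lambda borel_measurable_divide det gram)
qed

section \<open>Independence and the union bound over candidate vertices\<close>

text \<open>Fubini: once the block \<open>X i\<close> with \<open>i \<in> S\<close> is frozen,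
  \<open>h\<close> is a constant vector, and the independent block over \<open>R\<close> contributes
  one factor \<open>q\<close> per index. This allows smallness to be tested at a random vector
  instead of a fixed one.\<close>

lemma (in prob_space) prob_small_after_restriction_le:
  fixes X :: "'k::finite \<Rightarrow> 'a \<Rightarrow> 'v::topological_space" and c :: "'p::finite \<Rightarrow> 'v \<Rightarrow> real ^ 'n"
  assumes indep: "indep_vars (\<lambda>_. borel) X UNIV"
    and c [measurable]: "\<And>p. c p \<in> borel_measurable borel"
    and small: "\<And>i u. 1 \<le> norm u \<Longrightarrow> prob {x\<in>space M. \<forall>p. \<bar>c p (X i x) \<bullet> u\<bar> \<le> s} \<le> q"
    and SR: "S \<inter> R = {}"
    and h [measurable]: "h \<in> borel_measurable (PiM S (\<lambda>_. borel))"
    and q: "0 \<le> q"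
  defines "E \<equiv> {x\<in>space M. 1 \<le> norm (h (\<lambda>i\<in>S. X i x)) \<and>
                   (\<forall>i\<in>R. \<forall>p. \<bar>c p (X i x) \<bullet> h (\<lambda>i\<in>S. X i x)\<bar> \<le> s)}"
  shows "E \<in> events" "prob E \<le> q ^ card R"
proof -
  let ?S = "PiM S (\<lambda>_. borel :: 'v measure)" and ?R = "PiM R (\<lambda>_. borel :: 'v measure)"
  let ?XS = "\<lambda>x. \<lambda>i\<in>S. X i x" and ?XR = "\<lambda>x. \<lambda>i\<in>R. X i x"
  have X [measurable]: "X i \<in> borel_measurable M" for i
    using indep by (auto simp: indep_vars_def)
  have XS [measurable]: "?XS \<in> measurable M ?S" and XR [measurable]: "?XR \<in> measurable M ?R"
    by (auto intro!: measurable_restrict)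
  define A where "A = {z\<in>space (?S \<Otimes>\<^sub>M ?R). 1 \<le> norm (h (fst z)) \<and>
     (\<forall>i\<in>R. \<forall>p. \<bar>c p (snd z i) \<bullet> h (fst z)\<bar> \<le> s)}"
  have comp [measurable]: "(\<lambda>z. snd z i) \<in> borel_measurable (?S \<Otimes>\<^sub>M ?R)" if "i \<in> R" for i
    using that by measurable
  have A: "A \<in> sets (?S \<Otimes>\<^sub>M ?R)"
    unfolding A_def by measurable
  have E_eq: "E = (\<lambda>x. (?XS x, ?XR x)) -` A \<inter> space M"
    using measurable_space[OF XS] measurable_space[OF XR]
    by (auto simp: E_def A_def space_pair_measure)
  show "E \<in> events"
    unfolding E_eq using A by measurable
  have "distr M ?S ?XS \<Otimes>\<^sub>M distr M ?R ?XR = distr M (?S \<Otimes>\<^sub>M ?R) (\<lambda>x. (?XS x, ?XR x))"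
    using indep_var_restrict[OF indep SR] by (simp add: indep_var_distribution_eq)
  then have "emeasure M E = emeasure (distr M ?S ?XS \<Otimes>\<^sub>M distr M ?R ?XR) A"
    unfolding E_eq using A by (simp add: emeasure_distr)
  also have "\<dots> = (\<integral>\<^sup>+y. emeasure (distr M ?R ?XR) (Pair y -` A) \<partial>distr M ?S ?XS)"
    by (intro sigma_finite_measure.emeasure_pair_measure_alt prob_space_imp_sigma_finite
        prob_space_distr XR) (use A in simp)
  also have "\<dots> \<le> (\<integral>\<^sup>+y. ennreal (q ^ card R) \<partial>distr M ?S ?XS)"
  proof (rule nn_integral_mono)
    fix y assume "y \<in> space (distr M ?S ?XS)"
    then have y: "y \<in> space ?S" by simp
    show "emeasure (distr M ?R ?XR) (Pair y -` A) \<le> ennreal (q ^ card R)"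
    \<comment> \<open>\<open>indep_varsD\<close> requires a nonempty index set, so
      \<open>R = {}\<close> is treated apart, with bound \<open>q ^ 0 = 1\<close>. If
      \<open>norm (h y) < 1\<close> and \<open>R\<close> is nonempty, the section of
      \<open>A\<close> is empty.\<close>
    proof (cases "1 \<le> norm (h y) \<and> R \<noteq> {}")
      case True
      define B where "B = {v. \<forall>p. \<bar>c p v \<bullet> h y\<bar> \<le> s}"
      have B: "B \<in> sets borel"
        unfolding B_def by measurable
      have "emeasure (distr M ?R ?XR) (Pair y -` A) = emeasure M (?XR -` (Pair y -` A) \<inter> space M)"
        by (rule emeasure_distr[OF XR sets_Pair1[OF A]])
      also have "?XR -` (Pair y -` A) \<inter> space M = (\<Inter>i\<in>R. X i -` B \<inter> space M)"
        using True y measurable_space[OF XR] by (auto simp: A_def B_def space_pair_measure)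
      also have "emeasure M \<dots> = ennreal (\<Prod>i\<in>R. prob (X i -` B \<inter> space M))"
        using indep_varsD[OF indep, of R "\<lambda>_. B"] True B by (simp only: emeasure_eq_measure) simp
      also have "\<dots> \<le> ennreal (\<Prod>i\<in>R. q)"
      proof (intro ennreal_leI prod_mono conjI measure_nonneg)
        fix i
        have "X i -` B \<inter> space M = {x\<in>space M. \<forall>p. \<bar>c p (X i x) \<bullet> h y\<bar> \<le> s}"
          by (auto simp: B_def)
        then show "prob (X i -` B \<inter> space M) \<le> q"
          using small[of "h y" i] True by simp
      qed
      finally show ?thesis by (simp only: prod_constant)
    next
      case False
      show ?thesis
      proof (cases "R = {}")
        case True
        then show ?thesis
          using prob_space.emeasure_le_1[OF prob_space_distr[OF XR], of "Pair y -` A"] by simp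
      next
        case R: False
        then have "Pair y -` A = {}" using False by (auto simp: A_def)
        then show ?thesis by simp
      qed
    qed
  qed
  also have "\<dots> = ennreal (q ^ card R)"
    using prob_space.emeasure_space_1[OF prob_space_distr[OF XS]] by simp
  finally show "prob E \<le> q ^ card R"
    using q by (simp add: emeasure_eq_measure)
qed

text \<open>\<open>E\<close> is a finite union that catches each bad \<open>x\<close> through a
  vertex. There are at most \<open>2 ^ CARD('k)\<close> choices of \<open>I\<close> and at most
  \<open>3 ^ (CARD('k) * CARD('p) + CARD('n))\<close> sign patterns. A vertex uses up at most
  \<open>CARD('n)\<close> samples, so at least \<open>m - CARD('n)\<close> factors \<open>q\<close>
  remain.\<close>

theorem (in prob_space) uniform_small_ball:
  fixes X :: "'k::finite \<Rightarrow> 'a \<Rightarrow> 'v::topological_space" and c :: "'p::finite \<Rightarrow> 'v \<Rightarrow> real ^ 'n"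
  assumes indep: "indep_vars (\<lambda>_. borel) X UNIV"
    and c: "\<And>p. c p \<in> borel_measurable borel"
    and small: "\<And>i u. 1 \<le> norm u \<Longrightarrow> prob {x\<in>space M. \<forall>p. \<bar>c p (X i x) \<bullet> u\<bar> \<le> s} \<le> q"
    and q: "0 \<le> q" "q \<le> 1"
  obtains E where "E \<in> events"
    "prob E \<le> 2 ^ CARD('k) * 3 ^ (CARD('k) * CARD('p) + CARD('n)) * q ^ (m - CARD('n))"
    "\<And>x u I. \<lbrakk>x \<in> space M; norm u = 1; m \<le> card I; \<forall>i\<in>I. \<forall>p. \<bar>c p (X i x) \<bullet> u\<bar> \<le> s\<rbrakk> \<Longrightarrow> x \<in> E"
proof -
  \<comment> \<open>Normals of the constraints: \<open>Inl (i, p)\<close> is the slab of half-width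
    \<open>s\<close> coming from part \<open>p\<close> of sample \<open>i\<close>, and
    \<open>Inr l\<close> is the box constraint on coordinate \<open>l\<close>, of half-width
    1.\<close>
  define C :: "('k \<Rightarrow> 'v) \<Rightarrow> ('k \<times> 'p) + 'n \<Rightarrow> real ^ 'n"
    where "C y t = (case t of Inl (i, p) \<Rightarrow> c p (y i) | Inr l \<Rightarrow> axis l 1)" for y t
  define w :: "('k \<times> 'p) + 'n \<Rightarrow> real" where "w t = (case t of Inl _ \<Rightarrow> s | Inr _ \<Rightarrow> 1)" for t
  define S :: "(('k \<times> 'p) + 'n) set \<Rightarrow> 'k set" where "S T = {i. \<exists>p. Inl (i, p) \<in> T}" for T
  define supp :: "(('k \<times> 'p) + 'n \<Rightarrow> real) \<Rightarrow> (('k \<times> 'p) + 'n) set"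
    where "supp \<sigma> = {t. \<sigma> t \<noteq> 0}" for \<sigma>
  \<comment> \<open>The candidate vertex of sign pattern \<open>\<sigma>\<close>: the constraint \<open>t\<close> is tight with sign \<open>\<sigma> t\<close>, or ignored if \<open>\<sigma> t = 0\<close>.\<close>
  define h where "h \<sigma> y = normal_solve (supp \<sigma>) (C y) (\<lambda>t. \<sigma> t * w t)" for \<sigma> y
  \<comment> \<open>The samples in \<open>S (supp \<sigma>)\<close> determine the vertex, so
    smallness is recorded only for the other indices of \<open>I\<close>.\<close>
  define E where "E I \<sigma> = {x\<in>space M. 1 \<le> norm (h \<sigma> (\<lambda>i\<in>S (supp \<sigma>). X i x)) \<and>
      (\<forall>i\<in>I - S (supp \<sigma>). \<forall>p. \<bar>c p (X i x) \<bullet> h \<sigma> (\<lambda>i\<in>S (supp \<sigma>). X i x)\<bar> \<le> s)}" for I \<sigma>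
  define \<Sigma> :: "(('k \<times> 'p) + 'n \<Rightarrow> real) set"
    where "\<Sigma> = {\<sigma> \<in> UNIV \<rightarrow>\<^sub>E {-1, 0, 1}. card (supp \<sigma>) \<le> CARD('n)}"
  define \<I> :: "'k set set" where "\<I> = {I. m \<le> card I}"
  \<comment> \<open>The system of \<open>\<sigma>\<close> reads \<open>y\<close> only at indices in
    \<open>S (supp \<sigma>)\<close>, hence measurability with respect to that block alone.\<close>
  have h_meas: "h \<sigma> \<in> borel_measurable (PiM (S (supp \<sigma>)) (\<lambda>_. borel))" for \<sigma>
    unfolding h_def
  proof (rule borel_measurable_normal_solve)
    fix t assume t: "t \<in> supp \<sigma>"
    have ci: "(\<lambda>y. c p (y i)) \<in> borel_measurable (PiM A (\<lambda>_. borel))" if "i \<in> A" for p i A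
      using measurable_compose[OF measurable_component_singleton[OF that, of "\<lambda>_. borel"] c] .
    show "(\<lambda>y. C y t) \<in> borel_measurable (PiM (S (supp \<sigma>)) (\<lambda>_. borel))"
    proof (cases t)
      case (Inl ip)
      with t have "fst ip \<in> S (supp \<sigma>)" by (auto simp: S_def intro: exI[of _ "snd ip"])
      then show ?thesis
        unfolding C_def Inl
        by (cases ip) (simp add: ci)
    qed (simp add: C_def)
  qed
  have disj: "S (supp \<sigma>) \<inter> (I - S (supp \<sigma>)) = {}" for I \<sigma> by auto
  note E_facts = prob_small_after_restriction_le[OF indep c small disj h_meas q(1)]
  have E_event: "E I \<sigma> \<in> events" for I \<sigma>
    unfolding E_def by (rule E_facts(1))
  have E_prob: "prob (E I \<sigma>) \<le> q ^ (m - CARD('n))" if "I \<in> \<I>" "\<sigma> \<in> \<Sigma>" for I \<sigma>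
  proof -
    have "S (supp \<sigma>) \<subseteq> (fst \<circ> projl) ` supp \<sigma>"
      by (force simp: S_def)
    then have "card (S (supp \<sigma>)) \<le> card (supp \<sigma>)"
      by (meson card_image_le card_mono finite_code finite_imageI le_trans)
    also have "\<dots> \<le> CARD('n)" using that by (simp add: \<Sigma>_def)
    finally have "m - CARD('n) \<le> card I - card (S (supp \<sigma>))"
      using that by (simp add: \<I>_def)
    also have "\<dots> \<le> card (I - S (supp \<sigma>))"
      by (rule diff_card_le_card_Diff) simp
    finally have "q ^ card (I - S (supp \<sigma>)) \<le> q ^ (m - CARD('n))"
      using q by (rule power_decreasing)
    with E_facts(2)[of \<sigma> I] show ?thesis
      unfolding E_def by linarith
  qed
  have fin: "finite (UNIV \<rightarrow>\<^sub>E {-1, 0, 1} :: (('k \<times> 'p) + 'n \<Rightarrow> real) set)"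
    by (intro finite_PiE) auto
  then have fin\<Sigma>: "finite \<Sigma>" by (simp add: \<Sigma>_def)
  have card\<Sigma>: "card \<Sigma> \<le> 3 ^ (CARD('k) * CARD('p) + CARD('n))"
  proof -
    have "card \<Sigma> \<le> card (UNIV \<rightarrow>\<^sub>E {-1, 0, 1} :: (('k \<times> 'p) + 'n \<Rightarrow> real) set)"
      by (rule card_mono[OF fin]) (auto simp: \<Sigma>_def)
    then show ?thesis by (simp add: card_PiE numeral_3_eq_3)
  qed
  have card\<I>: "card \<I> \<le> 2 ^ CARD('k)"
    using card_mono[of "Pow UNIV" \<I>] by (auto simp: card_Pow)
  let ?E = "\<Union>(I, \<sigma>)\<in>\<I> \<times> \<Sigma>. E I \<sigma>"
  have "?E \<in> events"
    using E_event fin\<Sigma> by (intro sets.finite_UN) auto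
  moreover have "prob ?E \<le> 2 ^ CARD('k) * 3 ^ (CARD('k) * CARD('p) + CARD('n)) * q ^ (m - CARD('n))"
  proof -
    have "prob ?E \<le> (\<Sum>z\<in>\<I> \<times> \<Sigma>. prob (case z of (I, \<sigma>) \<Rightarrow> E I \<sigma>))"
      using E_event fin\<Sigma> by (intro finite_measure_subadditive_finite) auto
    also have "\<dots> \<le> (\<Sum>z\<in>\<I> \<times> \<Sigma>. q ^ (m - CARD('n)))"
      using E_prob by (intro sum_mono) auto
    also have "\<dots> = real (card \<I>) * real (card \<Sigma>) * q ^ (m - CARD('n))"
      by (simp add: card_cartesian_product)
    also have "\<dots> \<le> real (2 ^ CARD('k)) * real (3 ^ (CARD('k) * CARD('p) + CARD('n))) * q ^ (m - CARD('n))"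
      using card\<I> card\<Sigma> q by (intro mult_mono of_nat_mono) auto
    finally show ?thesis by simp
  qed
  moreover have "x \<in> ?E"
    if x: "x \<in> space M" and u: "norm u = 1" and I: "m \<le> card I"
      and le: "\<forall>i\<in>I. \<forall>p. \<bar>c p (X i x) \<bullet> u\<bar> \<le> s" for x u I
  proof -
    define y where "y = (\<lambda>i. X i x)"
    \<comment> \<open>Only the slabs of indices in \<open>I\<close> are imposed. The box constraints
      are always present; they hold for the unit vector \<open>u\<close> and make the polytope
      bounded.\<close>
    define J where "J = Inl ` (I \<times> (UNIV :: 'p set)) \<union> Inr ` (UNIV :: 'n set)"
    have box: "\<forall>t\<in>J. \<bar>C y t \<bullet> u\<bar> \<le> w t"
      using le u component_le_norm_cart[of u] by (auto simp: J_def C_def w_def y_def inner_axis')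
    have "bounded {u. \<forall>t\<in>J. \<bar>C y t \<bullet> u\<bar> \<le> w t}"
    proof (rule bounded_subset[OF bounded_cbox])
      show "{u. \<forall>t\<in>J. \<bar>C y t \<bullet> u\<bar> \<le> w t} \<subseteq> cbox (\<chi> i. -1) (\<chi> i. 1)"
        by (auto simp: J_def C_def w_def inner_axis' mem_box_cart abs_le_iff ball_Un)
    qed
    then obtain v T where v: "norm u \<le> norm v" "\<forall>t\<in>J. \<bar>C y t \<bullet> v\<bar> \<le> w t" and T: "T \<subseteq> J"
      "card T \<le> CARD('n)" "\<forall>t\<in>T. \<bar>C y t \<bullet> v\<bar> = w t" "\<And>z. \<forall>t\<in>T. C y t \<bullet> z = 0 \<Longrightarrow> z = 0"
      using norm_maximizer_tight[OF _ _ box] by auto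
    \<comment> \<open>The sign is 1 also when the inner product vanishes, so that the support is
      exactly \<open>T\<close>; in that case \<open>w t = 0\<close> by tightness and the equation is
      unaffected.\<close>
    define \<sigma> where "\<sigma> t = (if t \<in> T then (if 0 \<le> C y t \<bullet> v then 1 else - 1) else 0 :: real)" for t
    have supp: "supp \<sigma> = T" by (auto simp: supp_def \<sigma>_def)
    have "C (restrict y (S T)) t = C y t" if "t \<in> T" for t
      using that by (cases t) (auto simp: C_def S_def)
    then have "normal_solve T (C (restrict y (S T))) (\<lambda>t. \<sigma> t * w t) = v"
      using T by (intro normal_solve_eq) (auto simp: \<sigma>_def abs_if)
    then have hv: "h \<sigma> (restrict y (S (supp \<sigma>))) = v"
      by (simp add: h_def supp)
    have "\<bar>c p (y i) \<bullet> v\<bar> \<le> s" if "i \<in> I" for i p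
      using v(2)[rule_format, of "Inl (i, p)"] that by (simp add: J_def C_def w_def)
    then have "x \<in> E I \<sigma>"
      using x u v(1) hv by (auto simp: E_def y_def)
    moreover have "\<sigma> \<in> \<Sigma>"
      unfolding \<Sigma>_def using T(2) by (simp add: supp PiE_UNIV_domain) (simp add: \<sigma>_def)
    moreover have "I \<in> \<I>" using I by (simp add: \<I>_def)
    ultimately show ?thesis by blast
  qed
  ultimately show ?thesis by (rule that)
qed

section \<open>Real coordinates and the quadratic form of the sketch\<close>

lemma linear_eq_inner_axis:
  fixes f :: "real ^ 'n \<Rightarrow> real"
  assumes "linear f"
  shows "f u = (\<chi> l. f (axis l 1)) \<bullet> u"
proof -
  have "f u = f (\<Sum>l\<in>UNIV. u $ l *\<^sub>R axis l 1)"
    by (simp add: basis_expansion flip: scalar_mult_eq_scaleR)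
  also have "\<dots> = (\<Sum>l\<in>UNIV. u $ l * f (axis l 1))"
    using assms by (simp add: linear_sum linear_cmul)
  finally show ?thesis
    by (simp add: inner_vec_def mult.commute)
qed

lemma norm_vec_power2: "(norm (x :: 'f::real_normed_vector ^ 'n))\<^sup>2 = (\<Sum>i\<in>UNIV. (norm (x $ i))\<^sup>2)"
  by (simp add: norm_vec_def L2_set_def sum_nonneg)

text \<open>
  Parameters of the two cases: \<open>n = r\<close> with the identity as single part over the reals, and \<open>n = 2 r\<close>
  with real and imaginary part over the complex numbers.
\<close>

locale real_coordinates =
  fixes part :: "'p::finite \<Rightarrow> 'f::{conjugatable_field, real_normed_field, euclidean_space} \<Rightarrow> real"
    and \<phi> :: "real ^ 'n \<Rightarrow> 'f ^ 'r"
  assumes conjugate_mult_self: "\<And>z :: 'f. conjugate z * z = of_real ((norm z)\<^sup>2)"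
    and linear_conjugate: "linear (conjugate :: 'f \<Rightarrow> 'f)"
    and linear_part: "\<And>p. linear (part p)"
    and part_le: "\<And>p z. \<bar>part p z\<bar> \<le> norm z"
    and norm_le_parts: "\<And>z s. (\<And>p. \<bar>part p z\<bar> \<le> s) \<Longrightarrow> (norm z)\<^sup>2 \<le> 2 * s\<^sup>2"
    and linear_\<phi>: "linear \<phi>"
    and norm_\<phi>: "\<And>w. norm (\<phi> w) = norm w"
    and surj_\<phi>: "surj \<phi>"
begin

lemma conj_inner_self: "conj_inner x x = of_real ((norm (x :: 'f ^ 'm))\<^sup>2)"
  by (simp add: conj_inner_def conjugate_mult_self norm_vec_power2)

lemma conj_inner_add_left: "conj_inner (x + y) z = conj_inner x z + conj_inner y (z :: 'f ^ 'm)"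
  by (simp add: conj_inner_def conjugate_dist_add distrib_right sum.distrib)

lemma conj_inner_scaleR_left: "conj_inner (a *\<^sub>R x) z = a *\<^sub>R conj_inner x (z :: 'f ^ 'm)"
  by (simp add: conj_inner_def linear_cmul[OF linear_conjugate] scaleR_sum_right)

lemma continuous_conj_inner [continuous_intros]:
  "continuous_on A f \<Longrightarrow> continuous_on A (\<lambda>y. conj_inner x (f y :: 'f ^ 'm))"
  unfolding conj_inner_def by (intro continuous_intros)

lemma conj_inner_mult_vec:
  fixes Q :: "'f ^ 'r ^ 'd"
  shows "conj_inner (Q *v u) (Q *v v) =
    (\<Sum>i\<in>UNIV. \<Sum>j\<in>UNIV. conjugate (u $ i) * v $ j * conj_inner (column i Q) (column j Q))"
proof -
  have "conj_inner (Q *v u) (Q *v v) = (\<Sum>l\<in>UNIV. \<Sum>i\<in>UNIV. \<Sum>j\<in>UNIV.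
      conjugate (Q $ l $ i) * conjugate (u $ i) * (Q $ l $ j * v $ j))"
    by (simp add: conj_inner_def matrix_vector_mult_def sum_conjugate conjugate_dist_mul sum_product)
  also have "\<dots> = (\<Sum>i\<in>UNIV. \<Sum>j\<in>UNIV. \<Sum>l\<in>UNIV.
      conjugate (Q $ l $ i) * conjugate (u $ i) * (Q $ l $ j * v $ j))"
    by (subst sum.swap) (intro sum.cong refl sum.swap)
  also have "\<dots> = (\<Sum>i\<in>UNIV. \<Sum>j\<in>UNIV.
      conjugate (u $ i) * v $ j * conj_inner (column i Q) (column j Q))"
    by (simp add: conj_inner_def column_def sum_distrib_left mult_ac)
  finally show ?thesis .
qed

lemma norm_orthonormal_mult_vec:
  fixes Q :: "'f ^ 'r ^ 'd"
  assumes "orthonormal_columns Q"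
  shows "norm (Q *v u) = norm u"
proof -
  have "conj_inner (Q *v u) (Q *v u) =
    (\<Sum>i\<in>UNIV. \<Sum>j\<in>UNIV. if i = j then conjugate (u $ i) * u $ j else 0)"
    unfolding conj_inner_mult_vec
    using assms by (intro sum.cong refl) (simp add: orthonormal_columns_def)
  also have "\<dots> = conj_inner u u"
    by (simp add: conj_inner_def)
  finally have "(norm (Q *v u))\<^sup>2 = (norm u)\<^sup>2"
    unfolding conj_inner_self of_real_eq_iff .
  then show ?thesis by simp
qed

text \<open>Entry \<open>j\<close> of the row is \<open>conj_inner (Q *v u) (x j)\<close> scaled by
  one over the square root of \<open>CARD('k)\<close>, since
  \<open>u* Q* x = (Q u)* x\<close>.\<close>

lemma norm_row_sketch:
  fixes Q :: "'f ^ 'r ^ 'd" and x :: "'k::finite \<Rightarrow> 'f ^ 'd"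
  shows "(norm (conj_vec u v* (conj_transpose Q ** sketch_matrix x)))\<^sup>2 =
    (\<Sum>j\<in>UNIV. (norm (conj_inner (Q *v u) (x j)))\<^sup>2) / CARD('k)"
proof -
  have "(conj_vec u v* (conj_transpose Q ** sketch_matrix x)) $ j =
      of_real (1 / sqrt (CARD('k))) * conj_inner (Q *v u) (x j)" for j
  proof -
    have "(conj_vec u v* (conj_transpose Q ** sketch_matrix x)) $ j = (\<Sum>i\<in>UNIV. \<Sum>l\<in>UNIV.
        conjugate (u $ i) * (conjugate (Q $ l $ i) * (of_real (1 / sqrt (CARD('k))) * x j $ l)))"
      by (simp add: conj_vec_def vector_matrix_mult_def matrix_matrix_mult_def conj_transpose_def
          sketch_matrix_def sum_distrib_left)
    also have "\<dots> = (\<Sum>l\<in>UNIV. \<Sum>i\<in>UNIV.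
        conjugate (u $ i) * (conjugate (Q $ l $ i) * (of_real (1 / sqrt (CARD('k))) * x j $ l)))"
      by (rule sum.swap)
    also have "\<dots> = of_real (1 / sqrt (CARD('k))) * conj_inner (Q *v u) (x j)"
      by (simp add: conj_inner_def matrix_vector_mult_def sum_conjugate conjugate_dist_mul
          sum_distrib_left sum_distrib_right mult_ac)
    finally show ?thesis .
  qed
  then show ?thesis
    by (simp add: norm_vec_power2 norm_mult power_mult_distrib power_divide norm_divide
        sum_divide_distrib)
qed

text \<open>The infimum runs over a nonempty set bounded below, so it turns into a quantifier over
  \<open>u\<close>, and \<open>0 \<le> a\<close> permits squaring. The resulting condition is closed
  in \<open>x\<close>, from which the good event gets its measurability.\<close>

lemma sigma_min_ge_iff:
  fixes Q :: "'f ^ 'r ^ 'd" and x :: "'k::finite \<Rightarrow> 'f ^ 'd"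
  assumes "0 \<le> a"
  shows "a \<le> sigma_min (conj_transpose Q ** sketch_matrix x) \<longleftrightarrow>
    (\<forall>u. norm u = 1 \<longrightarrow> a\<^sup>2 \<le> (\<Sum>j\<in>UNIV. (norm (conj_inner (Q *v u) (x j)))\<^sup>2) / CARD('k))"
proof -
  let ?f = "\<lambda>u. norm (conj_vec u v* (conj_transpose Q ** sketch_matrix x))"
  have ne: "{u :: 'f ^ 'r. norm u = 1} \<noteq> {}"
    using vector_choose_size[of 1, where 'a = "'f ^ 'r"] by auto
  have "bdd_below (?f ` {u. norm u = 1})"
    by (rule bdd_belowI[of _ 0]) auto
  then have iff: "a \<le> sigma_min (conj_transpose Q ** sketch_matrix x) \<longleftrightarrow> (\<forall>u. norm u = 1 \<longrightarrow> a \<le> ?f u)"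
    unfolding sigma_min_def using le_cINF_iff[OF ne, of ?f a] by simp
  have "a \<le> ?f u \<longleftrightarrow> a\<^sup>2 \<le> (?f u)\<^sup>2" for u
    using assms by simp
  then show ?thesis
    unfolding iff norm_row_sketch by simp
qed

section \<open>From small-ball probabilities to the least singular value\<close>

text \<open>Markov's inequality for a coordinate \<open>\<omega> y $ i\<close>, whose second moment
  is the diagonal entry 1 of the identity. The bound on \<open>\<tau>\<close> is what later turns
  \<open>(\<tau> / 10)\<^sup>2\<close> into a small multiple of \<open>\<tau>\<close>.\<close>

lemma isotropic_small_ball_le:
  fixes \<omega> :: "'b \<Rightarrow> 'f ^ 'd"
  assumes "prob_space N" and \<omega>: "\<omega> \<in> borel_measurable N" and iso: "isotropic N \<omega>" and "0 \<le> \<tau>"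
    and small: "\<And>u. norm u = 1 \<Longrightarrow> \<P>(y in N. (norm (conj_inner u (\<omega> y)))\<^sup>2 \<ge> \<tau>) \<ge> q"
  shows "\<tau> * q \<le> 1"
proof -
  interpret N: prob_space N by fact
  obtain i :: 'd where True by blast
  have [measurable]: "(\<lambda>y. norm (\<omega> y $ i)) \<in> borel_measurable N"
    by (rule measurable_compose[OF \<omega>]) (intro borel_measurable_continuous_onI continuous_intros)
  have "bounded_linear (\<lambda>A :: 'f ^ 'd ^ 'd. A $ i $ i)"
    by (intro bounded_linear_compose[OF bounded_linear_vec_nth bounded_linear_vec_nth])
  from has_bochner_integral_bounded_linear[OF this iso[unfolded isotropic_def]]
  have "has_bochner_integral N (\<lambda>y. of_real ((norm (\<omega> y $ i))\<^sup>2)) (1 :: 'f)"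
    by (simp add: outer_self_def mat_def mult.commute[of _ "conjugate _"] conjugate_mult_self)
  note hbi = this
  then have int: "integrable N (\<lambda>y. (norm (\<omega> y $ i))\<^sup>2)"
    using integrable_norm[of N "\<lambda>y. of_real ((norm (\<omega> y $ i))\<^sup>2) :: 'f"]
    by (simp add: has_bochner_integral_iff norm_power)
  have "of_real (\<integral>y. (norm (\<omega> y $ i))\<^sup>2 \<partial>N) = (1 :: 'f)"
    using hbi integral_bounded_linear[OF bounded_linear_of_real[where 'a = 'f] int]
    by (simp add: has_bochner_integral_iff)
  then have E: "(\<integral>y. (norm (\<omega> y $ i))\<^sup>2 \<partial>N) = 1"
    by (metis of_real_eq_1_iff)
  have "conj_inner (axis i 1) (\<omega> y) = \<omega> y $ i" for y
  proof -
    have "conjugate (1 :: 'f) = 1" using conjugate_mult_self[of 1] by simp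
    then show ?thesis
      by (simp add: conj_inner_def axis_def if_distrib[of conjugate] if_distrib[of "\<lambda>z. z * _"]
          cong: if_cong)
  qed
  moreover have "norm (axis i 1 :: 'f ^ 'd) = 1"
  proof -
    have "(norm (axis i 1 :: 'f ^ 'd))\<^sup>2 = 1"
      unfolding norm_vec_power2
      by (simp add: axis_def if_distrib[of norm] if_distrib[of "\<lambda>z. z\<^sup>2"] cong: if_cong)
    then show ?thesis
      using norm_ge_zero[of "axis i 1 :: 'f ^ 'd"] unfolding power2_eq_1_iff by linarith
  qed
  ultimately have "q \<le> \<P>(y in N. \<tau> \<le> (norm (\<omega> y $ i))\<^sup>2)"
    using small[of "axis i 1"] by simp
  then have "\<tau> * q \<le> (\<integral>y. \<tau> * indicator {y\<in>space N. \<tau> \<le> (norm (\<omega> y $ i))\<^sup>2} y \<partial>N)"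
    using \<open>0 \<le> \<tau>\<close> by (simp add: mult_left_mono)
  also have "\<dots> \<le> (\<integral>y. (norm (\<omega> y $ i))\<^sup>2 \<partial>N)"
    by (intro integral_mono int integrable_mult_right integrable_real_indicator)
      (auto simp: N.emeasure_eq_measure split: split_indicator)
  finally show ?thesis using E by simp
qed

lemma sketch_injection:
  fixes M :: "'a measure" and N :: "'b measure" and \<omega> :: "'b \<Rightarrow> 'f ^ 'd"
    and X :: "'k::finite \<Rightarrow> 'a \<Rightarrow> 'f ^ 'd" and Q :: "'f ^ 'r ^ 'd"
  assumes "prob_space M" and N: "prob_space N" and "0 < \<tau>"
    and \<omega>: "\<omega> \<in> borel_measurable N" and iso: "isotropic N \<omega>" and iid: "iid_copies M X N \<omega>"
    and small: "\<And>u. norm u = 1 \<Longrightarrow> \<P>(y in N. (norm (conj_inner u (\<omega> y)))\<^sup>2 \<ge> \<tau>) \<ge> 0.99"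
    and Q: "orthonormal_columns Q"
    and \<delta>: "2 ^ CARD('k) * 3 ^ (CARD('k) * CARD('p) + CARD('n)) *
      0.01 ^ (nat \<lceil>0.97 * real CARD('k)\<rceil> - CARD('n)) \<le> \<delta>"
  shows "\<P>(x in M. sigma_min (conj_transpose Q ** sketch_matrix (\<lambda>i. X i x)) \<ge> \<tau> / 10) \<ge> 1 - \<delta>"
proof -
  interpret M: prob_space M by fact
  interpret N: prob_space N by fact
  let ?k = "real CARD('k)"
  \<comment> \<open>The factor 0.45 is below 1/2: if all parts of a scalar are at most
    \<open>s\<close> in absolute value, its squared norm is at most \<open>0.9 * \<tau>\<close>,
    hence below \<open>\<tau>\<close>.\<close>
  define s where "s = sqrt (0.45 * \<tau>)"
  define m where "m = nat \<lceil>0.97 * ?k\<rceil>"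
  \<comment> \<open>The vector representing the real-linear functional that sends \<open>u\<close>
    to \<open>part p (conj_inner (Q *v \<phi> u) y)\<close>.\<close>
  define c :: "'p \<Rightarrow> 'f ^ 'd \<Rightarrow> real ^ 'n"
    where "c p y = (\<chi> l. part p (conj_inner (Q *v \<phi> (axis l 1)) y))" for p y
  have s: "s\<^sup>2 = 0.45 * \<tau>" using \<open>0 < \<tau>\<close> by (simp add: s_def)
  have indep: "M.indep_vars (\<lambda>_. borel) X UNIV"
    and distr: "\<And>i. distr M borel (X i) = distr N borel \<omega>"
    using iid by (auto simp: iid_copies_def)
  have X: "X i \<in> borel_measurable M" for i
    using indep by (auto simp: M.indep_vars_def)
  have Q_add: "Q *v (u + v) = Q *v u + Q *v v" for u v
    by (rule matrix_vector_right_distrib)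
  have Q_scaleR: "Q *v (a *\<^sub>R u) = a *\<^sub>R (Q *v u)" for a u
    by (simp add: vec_eq_iff matrix_vector_mult_def scaleR_sum_right)
  have c_inner: "c p y \<bullet> u = part p (conj_inner (Q *v \<phi> u) y)" for p y u
  proof -
    have "linear (\<lambda>u. part p (conj_inner (Q *v \<phi> u) y))"
      by (rule linearI) (simp_all add: linear_add[OF linear_\<phi>] linear_cmul[OF linear_\<phi>] Q_add Q_scaleR
          conj_inner_add_left conj_inner_scaleR_left linear_add[OF linear_part] linear_cmul[OF linear_part])
    from linear_eq_inner_axis[OF this, of u] show ?thesis
      by (simp add: c_def)
  qed
  have c_meas: "c p \<in> borel_measurable borel" for p
    unfolding c_def
    by (intro borel_measurable_vec_lambda borel_measurable_continuous_onI continuous_intros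
        continuous_on_compose2[OF linear_continuous_on[OF linear_conv_bounded_linear[THEN iffD1, OF linear_part]]])
      auto
  have part_small: "M.prob {x\<in>space M. \<forall>p. \<bar>c p (X i x) \<bullet> u\<bar> \<le> s} \<le> 0.01" if u: "1 \<le> norm u" for i u
  proof -
    \<comment> \<open>\<open>small\<close> speaks of unit vectors only, hence the normalised
      \<open>?w\<close>. As \<open>1 \<le> norm u\<close>, passing back to \<open>?v\<close> can
      only enlarge the inner product.\<close>
    let ?v = "Q *v \<phi> u" and ?w = "(1 / norm u) *\<^sub>R (Q *v \<phi> u)"
    have w: "norm ?w = 1"
      using u by (auto simp: norm_orthonormal_mult_vec[OF Q] norm_\<phi>)
    define B where "B = {y. \<tau> \<le> (norm (conj_inner ?w y))\<^sup>2}"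
    have B: "B \<in> sets borel"
      unfolding B_def by (intro borel_closed closed_Collect_le continuous_intros)
    have "0.99 \<le> N.prob (\<omega> -` B \<inter> space N)"
      using small[OF w] by (simp add: B_def vimage_def Int_def conj_commute)
    also have "\<dots> = measure (distr N borel \<omega>) B"
      using B \<omega> by (simp add: measure_distr)
    also have "\<dots> = M.prob (X i -` B \<inter> space M)"
      using B X by (simp flip: distr[of i] add: measure_distr)
    finally have "M.prob (space M - (X i -` B \<inter> space M)) \<le> 0.01"
      using measurable_sets[OF X B] by (subst M.prob_compl) auto
    moreover have "{x\<in>space M. \<forall>p. \<bar>c p (X i x) \<bullet> u\<bar> \<le> s} \<subseteq> space M - (X i -` B \<inter> space M)"
    proof safe
      fix x assume le: "\<forall>p. \<bar>c p (X i x) \<bullet> u\<bar> \<le> s" and "X i x \<in> B"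
      then have "\<tau> \<le> (norm (conj_inner ?w (X i x)))\<^sup>2" by (simp add: B_def)
      also have "\<dots> = (norm (conj_inner ?v (X i x)))\<^sup>2 / (norm u)\<^sup>2"
        by (simp add: conj_inner_scaleR_left power_divide)
      also have "\<dots> \<le> (norm (conj_inner ?v (X i x)))\<^sup>2 / 1"
        using u by (intro divide_left_mono) auto
      also have "\<dots> \<le> 2 * s\<^sup>2"
        using norm_le_parts[of "conj_inner ?v (X i x)" s] le by (simp add: c_inner)
      also have "\<dots> < \<tau>" using \<open>0 < \<tau>\<close> by (simp add: s)
      finally show False by simp
    qed
    ultimately show ?thesis
      using M.finite_measure_mono[of _ "space M - (X i -` B \<inter> space M)"] measurable_sets[OF X B]
      by (meson order_trans sets.compl_sets)
  qed
  obtain E where E: "E \<in> M.events"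
    "M.prob E \<le> 2 ^ CARD('k) * 3 ^ (CARD('k) * CARD('p) + CARD('n)) * 0.01 ^ (m - CARD('n))"
    "\<And>x u I. \<lbrakk>x \<in> space M; norm u = 1; m \<le> card I; \<forall>i\<in>I. \<forall>p. \<bar>c p (X i x) \<bullet> u\<bar> \<le> s\<rbrakk> \<Longrightarrow> x \<in> E"
    using M.uniform_small_ball[OF indep c_meas part_small, where m = m] by auto
  have \<tau>: "\<tau> * 0.99 \<le> 1"
    using isotropic_small_ball_le[OF N \<omega> iso _ small] \<open>0 < \<tau>\<close> by simp
  let ?good = "{x\<in>space M. \<tau> / 10 \<le> sigma_min (conj_transpose Q ** sketch_matrix (\<lambda>i. X i x))}"
  have good: "space M - E \<subseteq> ?good"
  proof safe
    fix x assume x: "x \<in> space M" "x \<notin> E"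
    have "(\<tau> / 10)\<^sup>2 \<le> (\<Sum>j\<in>UNIV. (norm (conj_inner (Q *v u) (X j x)))\<^sup>2) / ?k" if u: "norm u = 1" for u
    proof (rule ccontr)
      define a where "a j = (norm (conj_inner (Q *v u) (X j x)))\<^sup>2" for j
      define I where "I = {j. a j \<le> 0.45 * \<tau>}"
      assume "\<not> (\<tau> / 10)\<^sup>2 \<le> (\<Sum>j\<in>UNIV. (norm (conj_inner (Q *v u) (X j x)))\<^sup>2) / ?k"
      then have sum_less: "(\<Sum>j\<in>UNIV. a j) < (\<tau> / 10)\<^sup>2 * ?k"
        by (simp add: a_def not_le pos_divide_less_eq)
      \<comment> \<open>Counting: each index outside \<open>I\<close> contributes more than
        \<open>0.45 * \<tau>\<close>, while \<open>\<tau> * 0.99 \<le> 1\<close> bounds the total by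
        \<open>\<tau> * ?k / 99\<close>. Hence fewer than \<open>?k / 44.55\<close>, in particular
        fewer than \<open>0.03 * ?k\<close>, indices lie outside \<open>I\<close>.\<close>
      have "real (card (- I)) * (0.45 * \<tau>) \<le> (\<Sum>j\<in>- I. a j)"
        by (rule sum_bounded_below) (simp add: I_def)
      also have "\<dots> \<le> (\<Sum>j\<in>UNIV. a j)"
        by (rule sum_mono2) (auto simp: a_def)
      also have "\<dots> < (\<tau> / 10)\<^sup>2 * ?k" by (rule sum_less)
      also have "\<dots> \<le> \<tau> * (?k / 99)"
        using mult_right_mono[OF \<tau>, of "\<tau> * ?k / 99"] \<open>0 < \<tau>\<close>
        by (simp add: power2_eq_square field_simps)
      finally have "\<tau> * (real (card (- I)) * 0.45) < \<tau> * (?k / 99)" by (simp add: mult_ac)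
      then have "real (card (- I)) * 0.45 < ?k / 99"
        using \<open>0 < \<tau>\<close> by simp
      moreover have "card (- I) = CARD('k) - card I" "card I \<le> CARD('k)"
        by (simp_all add: Compl_eq_Diff_UNIV card_Diff_subset card_mono)
      ultimately have "0.97 * ?k \<le> real (card I)"
        by (simp add: of_nat_diff)
      then have "m \<le> card I" by (simp add: m_def nat_le_iff ceiling_le_iff)
      moreover obtain w where w: "u = \<phi> w"
        using surj_\<phi> by (auto simp: surj_def)
      moreover have "\<bar>c p (X i x) \<bullet> w\<bar> \<le> s" if "i \<in> I" for i p
      proof -
        have "norm (conj_inner (Q *v u) (X i x)) \<le> s"
          using that real_le_rsqrt by (auto simp: I_def a_def s_def)
        with part_le[of p "conj_inner (Q *v u) (X i x)"] show ?thesis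
          by (simp add: c_inner w)
      qed
      ultimately have "x \<in> E"
        using E(3)[OF x(1), of w I] u norm_\<phi>[of w] by simp
      with x show False by simp
    qed
    then show "\<tau> / 10 \<le> sigma_min (conj_transpose Q ** sketch_matrix (\<lambda>i. X i x))"
      using \<open>0 < \<tau>\<close> by (subst sigma_min_ge_iff) auto
  qed
  have good_event: "?good \<in> M.events"
  proof -
    \<comment> \<open>The intersection over all unit vectors is uncountable, but each set in it is
      closed in the matrix of samples, so \<open>F\<close> is closed and therefore Borel.\<close>
    define F :: "('f ^ 'd ^ 'k) set" where "F = {Y. \<forall>u. norm u = 1 \<longrightarrow>
      (\<tau> / 10)\<^sup>2 \<le> (\<Sum>j\<in>UNIV. (norm (conj_inner (Q *v u) (Y $ j)))\<^sup>2) / ?k}"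
    have "F = (\<Inter>u\<in>{u. norm u = 1}.
      {Y. (\<tau> / 10)\<^sup>2 \<le> (\<Sum>j\<in>UNIV. (norm (conj_inner (Q *v u) (Y $ j)))\<^sup>2) / ?k})"
      by (auto simp: F_def)
    moreover have "closed \<dots>"
      by (intro closed_INT ballI closed_Collect_le continuous_intros) auto
    ultimately have "F \<in> sets borel" by (simp add: borel_closed)
    moreover have "(\<lambda>x. \<chi> j. X j x) \<in> borel_measurable M"
      by (intro borel_measurable_vec_lambda X)
    ultimately have "(\<lambda>x. \<chi> j. X j x) -` F \<inter> space M \<in> M.events"
      by (rule measurable_sets[rotated])
    also have "(\<lambda>x. \<chi> j. X j x) -` F \<inter> space M = ?good"
      using \<open>0 < \<tau>\<close> by (subst sigma_min_ge_iff) (auto simp: F_def)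
    finally show ?thesis .
  qed
  have "1 - \<delta> \<le> 1 - M.prob E"
    using E(2) \<delta> by (simp add: m_def)
  also have "\<dots> = M.prob (space M - E)"
    using E(1) by (simp add: M.prob_compl)
  also have "\<dots> \<le> M.prob ?good"
    by (rule M.finite_measure_mono[OF good good_event])
  finally show ?thesis .
qed

end

section \<open>Numerical estimates for the union bound\<close>

text \<open>From \<open>1 - 1 / K \<le> exp (- (1 / K))\<close> one gets
  \<open>b ^ k \<le> exp (- (k / K))\<close>. This is where the constants 10 and 57 in front of the
  logarithm enter as \<open>K\<close>.\<close>

lemma power_le_of_ln_le:
  fixes b \<delta> K :: real
  assumes "0 < K" "0 < \<delta>" "0 \<le> b" "b \<le> 1 - 1 / K" "K * ln (1 / \<delta>) \<le> real k"
  shows "b ^ k \<le> \<delta>"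
proof -
  have "b \<le> exp (- (1 / K))"
    using exp_ge_add_one_self[of "- (1 / K)"] assms by linarith
  then have "b ^ k \<le> exp (- (1 / K)) ^ k"
    using assms by (intro power_mono) auto
  also have "\<dots> = exp (- (real k / K))"
    by (simp flip: exp_of_nat_mult)
  also have "- (real k / K) \<le> ln \<delta>"
    using assms by (simp add: ln_div field_simps)
  then have "exp (- (real k / K)) \<le> exp (ln \<delta>)"
    by (simp only: exp_le_cancel_iff)
  finally show ?thesis using assms by simp
qed

text \<open>Cost per sample: 2 for membership in \<open>I\<close>, at most \<open>e\<close> ternary
  signs, and a gain of at least \<open>d\<close> factors 0.01 after the samples of the vertex are
  removed.\<close>

lemma union_bound_powr_le:
  assumes "real p + real n / real k \<le> e" "real n / real k + d \<le> 0.97" "0 \<le> d" "0 < k"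
  shows "2 ^ k * 3 ^ (k * p + n) * 0.01 ^ (nat \<lceil>0.97 * real k\<rceil> - n) \<le>
    (2 * 3 powr e * 0.01 powr d) ^ k"
proof -
  let ?m = "nat \<lceil>0.97 * real k\<rceil> - n"
  have le: "real k * real p + real n \<le> real k * e" "real n + real k * d \<le> 0.97 * real k"
    using assms by (auto simp: field_simps)
  have "3 ^ (k * p + n) = 3 powr (real k * real p + real n)"
    by (simp flip: powr_realpow)
  also have "\<dots> \<le> 3 powr (real k * e)"
    using le by (intro powr_mono) auto
  also have "\<dots> = (3 powr e) ^ k"
    by (simp add: powr_powr mult.commute flip: powr_realpow)
  finally have 3: "(3::real) ^ (k * p + n) \<le> (3 powr e) ^ k" .
  have "real k * d \<le> real ?m"
    using order_trans[OF le(2) of_nat_ceiling]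
    by (cases "n \<le> nat \<lceil>0.97 * real k\<rceil>") (simp_all add: of_nat_diff)
  then have "(0.01::real) powr real ?m \<le> 0.01 powr (real k * d)"
    by (intro powr_mono') auto
  also have "\<dots> = (0.01 powr d) ^ k"
    by (simp add: powr_powr mult.commute flip: powr_realpow)
  finally have "(0.01::real) ^ ?m \<le> (0.01 powr d) ^ k"
    by (simp add: powr_realpow)
  with 3 have "2 ^ k * 3 ^ (k * p + n) * 0.01 ^ ?m \<le> 2 ^ k * (3 powr e) ^ k * (0.01 powr d :: real) ^ k"
    by (intro mult_mono) auto
  then show ?thesis by (simp add: power_mult_distrib)
qed

text \<open>With \<open>e = m / n\<close>, comparing \<open>n\<close>-th powers reduces a numerical
  bound on a fractional power to rational arithmetic.\<close>

lemma powr_le_of_power_le: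
  fixes a b :: real
  assumes "0 < n" "0 < a" "0 \<le> b" "real n * e = real m" "a ^ m \<le> b ^ n"
  shows "a powr e \<le> b"
proof -
  have "(a powr e) ^ n = a powr (e * real n)"
    using assms by (simp add: powr_powr flip: powr_realpow)
  also have "\<dots> = a ^ m"
    using assms by (simp add: mult.commute[of e] powr_realpow)
  finally show ?thesis
    using assms power_mono_iff[of "a powr e" b n] by simp
qed

section \<open>The real and the complex case\<close>

theorem theoremC3:
  fixes M :: "'a measure" and N :: "'b measure"
    and \<omega>R :: "'b \<Rightarrow> real ^ 'd" and XR :: "'k::finite \<Rightarrow> 'a \<Rightarrow> real ^ 'd"
    and \<omega>C :: "'b \<Rightarrow> complex ^ 'd" and XC :: "'k::finite \<Rightarrow> 'a \<Rightarrow> complex ^ 'd"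
    and \<tau> \<delta> :: real
  assumes "prob_space M" and "prob_space N"
    and "\<tau> > 0" and "0 < \<delta>" and "\<delta> < 1"
  shows
    "(\<omega>R \<in> borel_measurable N \<longrightarrow> isotropic N \<omega>R \<longrightarrow> iid_copies M XR N \<omega>R \<longrightarrow>
      (\<forall>u. norm u = 1 \<longrightarrow> \<P>(y in N. (norm (conj_inner u (\<omega>R y)))\<^sup>2 \<ge> \<tau>) \<ge> 0.99) \<longrightarrow>
      real CARD('k) \<ge> max (4 * real CARD('r)) (10 * ln (1 / \<delta>)) \<longrightarrow>
      (\<forall>Q :: real ^ 'r ^ 'd. orthonormal_columns Q \<longrightarrow>
        \<P>(x in M. sigma_min (conj_transpose Q ** sketch_matrix (\<lambda>i. XR i x)) \<ge> \<tau> / 10) \<ge> 1 - \<delta>))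
     \<and>
     (\<omega>C \<in> borel_measurable N \<longrightarrow> isotropic N \<omega>C \<longrightarrow> iid_copies M XC N \<omega>C \<longrightarrow>
      (\<forall>u. norm u = 1 \<longrightarrow> \<P>(y in N. (norm (conj_inner u (\<omega>C y)))\<^sup>2 \<ge> \<tau>) \<ge> 0.99) \<longrightarrow>
      real CARD('k) \<ge> max (18 * real CARD('r)) (57 * ln (1 / \<delta>)) \<longrightarrow>
      (\<forall>Q :: complex ^ 'r ^ 'd. orthonormal_columns Q \<longrightarrow>
        \<P>(x in M. sigma_min (conj_transpose Q ** sketch_matrix (\<lambda>i. XC i x)) \<ge> \<tau> / 10) \<ge> 1 - \<delta>))"
proof (intro conjI impI allI)
  assume \<omega>: "\<omega>R \<in> borel_measurable N" "isotropic N \<omega>R" "iid_copies M XR N \<omega>R"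
    and small: "\<forall>u. norm u = 1 \<longrightarrow> \<P>(y in N. (norm (conj_inner u (\<omega>R y)))\<^sup>2 \<ge> \<tau>) \<ge> 0.99"
    and k: "real CARD('k) \<ge> max (4 * real CARD('r)) (10 * ln (1 / \<delta>))"
  fix Q :: "real ^ 'r ^ 'd"
  assume Q: "orthonormal_columns Q"
  interpret real_coordinates "\<lambda>(_ :: unit) z. z" "\<lambda>w :: real ^ 'r. w"
  proof (rule real_coordinates.intro)
    fix z s :: real assume "\<And>p :: unit. \<bar>z\<bar> \<le> s"
    then have "z\<^sup>2 \<le> s\<^sup>2" by (simp add: abs_le_square_iff[symmetric])
    then show "(norm z)\<^sup>2 \<le> 2 * s\<^sup>2"
      unfolding real_norm_def power2_abs using zero_le_power2[of s] by linarith
  qed (auto simp: power2_eq_square linear_iff)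
  \<comment> \<open>Here \<open>r / k \<le> 1 / 4\<close>, so \<open>e = 1 + 1 / 4\<close> and
    \<open>d = 0.97 - 0.25 = 0.72\<close>. The base is then at most
    \<open>2 * 4 * 0.04 = 0.32\<close>.\<close>
  have "(3::real) powr (5 / 4) \<le> 4" "(0.01::real) powr 0.72 \<le> 0.04"
    by (rule powr_le_of_power_le[of 4 _ _ _ 5] powr_le_of_power_le[of 25 _ _ _ 18]; simp add: power_divide)+
  then have "2 * 3 powr (5 / 4) * 0.01 powr 0.72 \<le> 2 * 4 * (0.04 :: real)"
    by (intro mult_mono) auto
  then have b: "2 * 3 powr (5 / 4) * 0.01 powr 0.72 \<le> 1 - 1 / (10 :: real)" by simp
  have "2 ^ CARD('k) * 3 ^ (CARD('k) * CARD(unit) + CARD('r)) *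
      0.01 ^ (nat \<lceil>0.97 * real CARD('k)\<rceil> - CARD('r)) \<le>
      (2 * 3 powr (5 / 4) * 0.01 powr 0.72 :: real) ^ CARD('k)"
    using k by (intro union_bound_powr_le) (auto simp: field_simps)
  also have "\<dots> \<le> \<delta>"
    using k \<open>0 < \<delta>\<close> b by (intro power_le_of_ln_le[of 10]) auto
  finally show "\<P>(x in M. sigma_min (conj_transpose Q ** sketch_matrix (\<lambda>i. XR i x)) \<ge> \<tau> / 10) \<ge> 1 - \<delta>"
    using small by (intro sketch_injection[OF assms(1,2,3) \<omega> _ Q]) auto
next
  assume \<omega>: "\<omega>C \<in> borel_measurable N" "isotropic N \<omega>C" "iid_copies M XC N \<omega>C"
    and small: "\<forall>u. norm u = 1 \<longrightarrow> \<P>(y in N. (norm (conj_inner u (\<omega>C y)))\<^sup>2 \<ge> \<tau>) \<ge> 0.99"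
    and k: "real CARD('k) \<ge> max (18 * real CARD('r)) (57 * ln (1 / \<delta>))"
  fix Q :: "complex ^ 'r ^ 'd"
  assume Q: "orthonormal_columns Q"
  define part where "part im z = (if im then Im z else Re z)" for im z
  define \<phi> :: "real ^ ('r \<times> bool) \<Rightarrow> complex ^ 'r"
    where "\<phi> w = (\<chi> i. Complex (w $ (i, False)) (w $ (i, True)))" for w
  interpret real_coordinates part \<phi>
  proof (rule real_coordinates.intro)
    show "conjugate z * z = of_real ((norm z)\<^sup>2)" for z :: complex
      using complex_norm_square[of z] by (simp add: mult.commute)
    show "linear (conjugate :: complex \<Rightarrow> complex)" by (simp add: linear_iff)
    show "linear (part im)" for im by (simp add: part_def linear_iff)
    show "\<bar>part im z\<bar> \<le> norm z" for im z
      by (simp add: part_def abs_Re_le_cmod abs_Im_le_cmod)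
    show "(norm z)\<^sup>2 \<le> 2 * s\<^sup>2" if "\<And>im. \<bar>part im z\<bar> \<le> s" for z s
    proof -
      have "\<bar>Re z\<bar>\<^sup>2 \<le> s\<^sup>2" "\<bar>Im z\<bar>\<^sup>2 \<le> s\<^sup>2"
        using power_mono[OF that[of False], of 2] power_mono[OF that[of True], of 2]
        by (simp_all add: part_def)
      then show ?thesis by (simp add: cmod_power2)
    qed
    show "linear \<phi>" by (simp add: \<phi>_def linear_iff vec_eq_iff complex_eq_iff)
    show "norm (\<phi> w) = norm w" for w
    proof -
      have "(norm (\<phi> w))\<^sup>2 = (\<Sum>i\<in>UNIV. \<Sum>im\<in>UNIV. (w $ (i, im))\<^sup>2)"
        by (simp add: norm_vec_power2 \<phi>_def cmod_power2 UNIV_bool add.commute)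
      also have "\<dots> = (norm w)\<^sup>2"
        by (simp add: norm_vec_power2 sum.cartesian_product)
      finally show ?thesis by simp
    qed
    show "surj \<phi>"
    proof (rule surjI)
      show "\<phi> (\<chi> l. part (snd l) (z $ fst l)) = z" for z
        by (simp add: \<phi>_def part_def vec_eq_iff)
    qed
  qed
  \<comment> \<open>With two parts and \<open>n = 2 * r\<close>, the bound
    \<open>n / k \<le> 1 / 9\<close> gives \<open>e = 2 + 1 / 9 = 19 / 9\<close>, and
    \<open>d = 0.85\<close> is below \<open>0.97 - 1 / 9\<close>. The base is at most
    \<open>2 * 10.26 * 0.02\<close>, about 0.41.\<close>
  have "(3::real) powr (1 / 9) \<le> 1.14"
    by (rule powr_le_of_power_le[of 9 _ _ _ 1]) (simp_all add: power_divide)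
  then have "(3::real) powr (19 / 9) \<le> 10.26"
    using powr_add[of "3::real" 2 "1 / 9"] by simp
  moreover have "(0.01::real) powr 0.85 \<le> 0.02"
    by (rule powr_le_of_power_le[of 20 _ _ _ 17]) (simp_all add: power_divide)
  ultimately have "2 * 3 powr (19 / 9) * 0.01 powr 0.85 \<le> 2 * 10.26 * (0.02 :: real)"
    by (intro mult_mono) auto
  then have b: "2 * 3 powr (19 / 9) * 0.01 powr 0.85 \<le> 1 - 1 / (57 :: real)" by simp
  have "2 ^ CARD('k) * 3 ^ (CARD('k) * CARD(bool) + CARD('r \<times> bool)) *
      0.01 ^ (nat \<lceil>0.97 * real CARD('k)\<rceil> - CARD('r \<times> bool)) \<le>
      (2 * 3 powr (19 / 9) * 0.01 powr 0.85 :: real) ^ CARD('k)"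
    using k by (intro union_bound_powr_le) (auto simp: field_simps)
  also have "\<dots> \<le> \<delta>"
    using k \<open>0 < \<delta>\<close> b by (intro power_le_of_ln_le[of 57]) auto
  finally show "\<P>(x in M. sigma_min (conj_transpose Q ** sketch_matrix (\<lambda>i. XC i x)) \<ge> \<tau> / 10) \<ge> 1 - \<delta>"
    using small by (intro sketch_injection[OF assms(1,2,3) \<omega> _ Q]) auto
qed

end
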